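(* (i) There exist edge expanders that are not triangle expanders. (ii) Assume the following conjecture: $G\sim G(n,p)$ with $p=\frac{\log n}{n^{2/3}}$ is a triangle expander with high probability (i.e., with probability tending to $1$ as $n\to\infty$). Then there exist triangle expanders that are not edge expanders.
   Context: Graphs are undirected. For a graph $G(V,E,w)$ on $n$ vertices with weight function $w:E\to\mathbb{R}^+$ (an unweighted graph $G(V,E)$ has all edge weights equal to $1$), let $\deg(u)=\sum_{v}w(u,v)$. For $S\subseteq V$ with complement $\bar S$, let $w(S:\bar S)=\sum_{i\in S,\,j\in\bar S}w(i,j)$ and $\mathrm{vol}(S)=\sum_{u\in S}\deg(u)$. The edge expansion of $S$ is $$\phi(S)=\frac{w(S:\bar S)}{\min(\mathrm{vol}(S),\mathrm{vol}(\bar S))}.$$ A graph $G(V,E,w)$ is an (edge) expander if all subsets $S\subseteq V$ with $|S|\le 0.5n$ have edge expansion $\phi(S)=\Theta(1)$. For an unweighted, undirected graph $G(V,E)$ on $n$ vertices, let $t(v)$ be the number of triangles containing the vertex $v$, let $t_i(S)$ be the number of triangles with exactly $i$ vertices in $S$, and let $\mathrm{vol}_3(S)=\sum_{v\in S}t(v)=3t_3(S)+2t_2(S)+t_1(S)$. The triangle expansion of $S$ is $$\phi_3(S)=\frac{t_2(S)+t_1(S)}{\mathrm{vol}_3(S)}.$$ A graph $G(V,E)$ is a triangle expander if all subsets $S\subseteq V$ with $|S|\le 0.5n$ have constant triangle expansion, i.e. $\phi_3(S)=\Theta(1)$. Here $S$ is nonempty, and the notions are understood asymptotically, for families of graphs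 with $n\to\infty$: $\Theta(1)$ means bounded below by a constant $c>0$ independent of $n$ and $S$ (both quantities are at most $1$). Both $\phi(S)$ and $\phi_3(S)$ are taken to be $0$ when the denominator is $0$. $G(n,p)$ is the Erdős–Rényi random graph on $n$ vertices, in which each pair of vertices is joined independently with probability $p$. *)

theory Defs
  imports "HOL-Probability.Probability" "HOL-Probability.Product_PMF" "HOL-Library.Ramsey"
begin

definition simple_graph :: "'a set \<Rightarrow> 'a set set \<Rightarrow> bool" where
  "simple_graph V E \<longleftrightarrow> finite V \<and> E \<subseteq> nsets V 2"


section \<open>Edge expansion of weighted graphs\<close>

definition edge_weight :: "'a set set \<Rightarrow> ('a set \<Rightarrow> real) \<Rightarrow> 'a \<Rightarrow> 'a \<Rightarrow> real" where
  "edge_weight E w u v = (if {u, v} \<in> E then w {u, v} else 0)"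

definition wdegree :: "'a set \<Rightarrow> 'a set set \<Rightarrow> ('a set \<Rightarrow> real) \<Rightarrow> 'a \<Rightarrow> real" where
  "wdegree V E w u = (\<Sum>v\<in>V. edge_weight E w u v)"

definition cut_weight :: "'a set \<Rightarrow> 'a set set \<Rightarrow> ('a set \<Rightarrow> real) \<Rightarrow> 'a set \<Rightarrow> real" where
  "cut_weight V E w S = (\<Sum>i\<in>S. \<Sum>j\<in>V - S. edge_weight E w i j)"

definition vol :: "'a set \<Rightarrow> 'a set set \<Rightarrow> ('a set \<Rightarrow> real) \<Rightarrow> 'a set \<Rightarrow> real" where
  "vol V E w S = (\<Sum>u\<in>S. wdegree V E w u)"

text \<open>Division by zero yields zero, so the expansion of a set is 0 when its denominator
  vanishes, both here and for triangle expansion below.\<close>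

definition edge_expansion :: "'a set \<Rightarrow> 'a set set \<Rightarrow> ('a set \<Rightarrow> real) \<Rightarrow> 'a set \<Rightarrow> real" where
  "edge_expansion V E w S = cut_weight V E w S / min (vol V E w S) (vol V E w (V - S))"

text \<open>The weights of an unweighted graph.\<close>

definition unit_weight :: "'a set \<Rightarrow> real" where
  "unit_weight e = 1"


section \<open>Triangle expansion of unweighted graphs\<close>

definition triangles :: "'a set \<Rightarrow> 'a set set \<Rightarrow> 'a set set" where
  "triangles V E = {T \<in> nsets V 3. nsets T 2 \<subseteq> E}"

definition triangles_at :: "'a set \<Rightarrow> 'a set set \<Rightarrow> 'a \<Rightarrow> nat" where
  "triangles_at V E v = card {T \<in> triangles V E. v \<in> T}"

definition triangles_meeting :: "'a set \<Rightarrow> 'a set set \<Rightarrow> nat \<Rightarrow> 'a set \<Rightarrow> nat" where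
  "triangles_meeting V E i S = card {T \<in> triangles V E. card (T \<inter> S) = i}"

definition vol3 :: "'a set \<Rightarrow> 'a set set \<Rightarrow> 'a set \<Rightarrow> nat" where
  "vol3 V E S = (\<Sum>v\<in>S. triangles_at V E v)"

definition triangle_expansion :: "'a set \<Rightarrow> 'a set set \<Rightarrow> 'a set \<Rightarrow> real" where
  "triangle_expansion V E S =
     real (triangles_meeting V E 2 S + triangles_meeting V E 1 S) / real (vol3 V E S)"


section \<open>Expanders\<close>

definition edge_expansion_ge ::
  "real \<Rightarrow> 'a set \<Rightarrow> 'a set set \<Rightarrow> ('a set \<Rightarrow> real) \<Rightarrow> bool" where
  "edge_expansion_ge c V E w \<longleftrightarrow>
     (\<forall>S \<subseteq> V. S \<noteq> {} \<and> 2 * card S \<le> card V \<longrightarrow> c \<le> edge_expansion V E w S)"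

definition triangle_expansion_ge :: "real \<Rightarrow> 'a set \<Rightarrow> 'a set set \<Rightarrow> bool" where
  "triangle_expansion_ge c V E \<longleftrightarrow>
     (\<forall>S \<subseteq> V. S \<noteq> {} \<and> 2 * card S \<le> card V \<longrightarrow> c \<le> triangle_expansion V E S)"

text \<open>
  Being an expander is a property of a sequence of graphs whose orders tend to infinity:
  expansion bounded below by a positive constant uniformly in the set and in the
  graph, up to finitely many members of the sequence. Ignoring finitely many members
  matters for the negation, which thus cannot be caused by a few degenerate
  small graphs. Since expansions are at most 1, the upper bound contained in
  \<open>\<Theta>(1)\<close> is automatic.
\<close>

definition graph_family :: "(nat \<Rightarrow> 'a set) \<Rightarrow> (nat \<Rightarrow> 'a set set) \<Rightarrow> bool" where
  "graph_family V E \<longleftrightarrow>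
     (\<forall>k. simple_graph (V k) (E k)) \<and> filterlim (\<lambda>k. card (V k)) at_top sequentially"

definition edge_expander ::
  "(nat \<Rightarrow> 'a set) \<Rightarrow> (nat \<Rightarrow> 'a set set) \<Rightarrow> (nat \<Rightarrow> 'a set \<Rightarrow> real) \<Rightarrow> bool" where
  "edge_expander V E w \<longleftrightarrow>
     (\<exists>c>0. \<forall>\<^sub>F k in sequentially. edge_expansion_ge c (V k) (E k) (w k))"

definition triangle_expander :: "(nat \<Rightarrow> 'a set) \<Rightarrow> (nat \<Rightarrow> 'a set set) \<Rightarrow> bool" where
  "triangle_expander V E \<longleftrightarrow>
     (\<exists>c>0. \<forall>\<^sub>F k in sequentially. triangle_expansion_ge c (V k) (E k))"


section \<open>Random graphs\<close>

text \<open>The distribution of the edge set of \<open>G(n,p)\<close> on the vertex set \<open>{..<n}\<close>, for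
  \<open>0 \<le> p \<le> 1\<close>.\<close>

definition gnp :: "nat \<Rightarrow> real \<Rightarrow> nat set set pmf" where
  "gnp n p = map_pmf (\<lambda>X. {e \<in> nsets {..<n} 2. X e})
     (Pi_pmf (nsets {..<n} 2) False (\<lambda>_. bernoulli_pmf p))"

definition gnp_triangle_expander_whp :: "(nat \<Rightarrow> real) \<Rightarrow> bool" where
  "gnp_triangle_expander_whp p \<longleftrightarrow>
     (\<exists>c>0. (\<lambda>n. measure_pmf.prob (gnp n (p n)) {E. triangle_expansion_ge c {..<n} E})
        \<longlonglongrightarrow> 1)"

end

theory Submission
  imports Defs
begin

text \<open>
  A star has no triangles, yet one side of every cut is an independent set, so every cut has
  edge expansion 1.

  In the other direction, take four hubs \<open>0, 1, 2, 3\<close> arranged in a 4-cycle and, on each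
  hub edge \<open>{i, i + 1}\<close>, a book of \<open>m\<close> triangles, each with its own leaf. Then join every
  leaf to every leaf of the opposite book. Opposite books share no hub, so this creates no
  triangle. A set separating two adjacent hubs cuts a whole book of \<open>m\<close> of the \<open>4 m\<close>
  triangles. A set containing no hub cuts the triangle of each of its leaves, and a set of at
  most half the vertices containing all hubs cuts the triangles of the remaining leaves. So
  triangle expansion is bounded below.
  But the leaves of one pair of opposite books span about \<open>m\<^sup>2\<close> edges and only \<open>4 m\<close>
  edges leave them.
\<close>

section \<open>Cuts and volumes\<close>

lemma edge_weight_commute: "edge_weight E w u v = edge_weight E w v u"
  by (simp add: edge_weight_def insert_commute)

lemma edge_weight_unit: "edge_weight E unit_weight u v = of_bool ({u, v} \<in> E)"
  by (simp add: edge_weight_def unit_weight_def)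

lemma cut_weight_Diff:
  assumes "S \<subseteq> V"
  shows "cut_weight V E w (V - S) = cut_weight V E w S"
proof -
  have "V - (V - S) = S" using assms by blast
  then show ?thesis
    unfolding cut_weight_def
    by (subst sum.swap) (simp add: edge_weight_commute)
qed

lemma cut_weight_le_vol:
  assumes "finite V" "S \<subseteq> V"
  shows "cut_weight V E unit_weight S \<le> vol V E unit_weight S"
  unfolding cut_weight_def vol_def wdegree_def
  using assms by (intro sum_mono sum_mono2) (auto simp: edge_weight_unit)

lemma cut_weight_independent:
  assumes "finite V" "S \<subseteq> V" and "\<And>u v. u \<in> S \<Longrightarrow> v \<in> S \<Longrightarrow> {u, v} \<notin> E"
  shows "cut_weight V E w S = vol V E w S"
  unfolding cut_weight_def vol_def wdegree_def
  using assms by (intro sum.cong sum.mono_neutral_left) (auto simp: edge_weight_def)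

lemma cut_weight_pos:
  assumes "finite V" "S \<subseteq> V" "u \<in> S" "v \<in> V - S" "{u, v} \<in> E"
  shows "cut_weight V E unit_weight S > 0"
proof -
  have "0 < (\<Sum>j\<in>V - S. edge_weight E unit_weight u j)"
    using assms by (intro sum_pos2[of _ v]) (auto simp: edge_weight_unit)
  moreover have "finite S" using assms finite_subset by blast
  moreover have "0 \<le> (\<Sum>j\<in>V - S. edge_weight E unit_weight i j)" for i
    by (intro sum_nonneg) (simp add: edge_weight_unit)
  ultimately show ?thesis
    unfolding cut_weight_def using \<open>u \<in> S\<close> by (intro sum_pos2[of S u])
qed

text \<open>The cut never exceeds the volume of either side and equals the volume of an independent
  side, so it is the minimum in the denominator. Positivity of the cut makes the quotient 1 and not
  the default value 0 of 0/0.\<close>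

lemma edge_expansion_independent:
  assumes "finite V" "S \<subseteq> V" "cut_weight V E unit_weight S > 0"
    and "(\<forall>u\<in>S. \<forall>v\<in>S. {u, v} \<notin> E) \<or> (\<forall>u\<in>V - S. \<forall>v\<in>V - S. {u, v} \<notin> E)"
  shows "edge_expansion V E unit_weight S = 1"
proof -
  have le: "cut_weight V E unit_weight S \<le> vol V E unit_weight S"
    "cut_weight V E unit_weight S \<le> vol V E unit_weight (V - S)"
    using cut_weight_le_vol[of V S E] cut_weight_le_vol[of V "V - S" E] assms(1,2)
    by (auto simp: cut_weight_Diff)
  have "cut_weight V E unit_weight S = vol V E unit_weight S \<or>
        cut_weight V E unit_weight S = vol V E unit_weight (V - S)"
    using assms(4) cut_weight_independent[of V S E unit_weight]
      cut_weight_independent[of V "V - S" E unit_weight] assms(1,2)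
    by (auto simp: cut_weight_Diff)
  with le have "min (vol V E unit_weight S) (vol V E unit_weight (V - S))
      = cut_weight V E unit_weight S"
    by (auto simp: min_def)
  with assms(3) show ?thesis by (simp add: edge_expansion_def)
qed


section \<open>Triangles\<close>

lemma nsets_2_triple:
  assumes "{x, y} \<in> E" "{x, z} \<in> E" "{y, z} \<in> E"
  shows "nsets {x, y, z} 2 \<subseteq> E"
proof
  fix e assume "e \<in> nsets {x, y, z} 2"
  then obtain a b where "e = {a, b}" "a \<noteq> b" "a \<in> {x, y, z}" "b \<in> {x, y, z}"
    unfolding nsets_def card_2_iff by blast
  then show "e \<in> E" using assms by (auto simp: insert_commute)
qed

text \<open>Sorting the vertices lets the later case analyses assume a single order; since small
  numbers serve as centre or hubs, the order also tells which vertices can be of which type.\<close>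

lemma triangle_vertices:
  fixes T :: "'a::linorder set"
  assumes "T \<in> triangles V E"
  obtains x y z where "T = {x, y, z}" "x < y" "y < z" "{x, y} \<in> E" "{y, z} \<in> E" "{x, z} \<in> E"
proof -
  have "card T = 3" and E: "nsets T 2 \<subseteq> E"
    using assms by (auto simp: triangles_def nsets_def)
  obtain a b c where abc: "T = {a, b, c}" "a \<noteq> b" "b \<noteq> c" "a \<noteq> c"
    using \<open>card T = 3\<close> unfolding card_3_iff by blast
  have "\<exists>x y z. {a, b, c} = {x, y, z} \<and> x < y \<and> y < z"
  proof -
    consider "a < b" "b < c" | "a < c" "c < b" | "b < a" "a < c"
      | "b < c" "c < a" | "c < a" "a < b" | "c < b" "b < a"
      using abc(2-4) by (metis linorder_neqE)
    then show ?thesis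
      by cases (metis insert_commute)+
  qed
  then obtain x y z where xyz: "T = {x, y, z}" "x < y" "y < z" using abc(1) by blast
  then have "{x, y} \<in> nsets T 2" "{y, z} \<in> nsets T 2" "{x, z} \<in> nsets T 2"
    by (auto simp: nsets_def)
  with E xyz show ?thesis by (intro that[of x y z]) blast+
qed

lemma finite_triangles: "finite V \<Longrightarrow> finite (triangles V E)"
  by (simp add: triangles_def finite_imp_finite_nsets)

text \<open>Double counting of the pairs of a vertex in \<open>S\<close> and a triangle containing
  it.\<close>

lemma vol3_eq_sum_card:
  assumes "finite V" "S \<subseteq> V"
  shows "vol3 V E S = (\<Sum>T\<in>triangles V E. card (T \<inter> S))"
proof -
  have fin: "finite S" "finite (triangles V E)"
    using assms finite_subset finite_triangles by blast+
  have "vol3 V E S = (\<Sum>v\<in>S. \<Sum>T\<in>triangles V E. of_bool (v \<in> T))"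
    unfolding vol3_def triangles_at_def using fin by (simp add: Int_def)
  also have "\<dots> = (\<Sum>T\<in>triangles V E. \<Sum>v\<in>S. of_bool (v \<in> T))"
    by (rule sum.swap)
  also have "\<dots> = (\<Sum>T\<in>triangles V E. card (T \<inter> S))"
    using fin by (simp add: Int_def conj_commute)
  finally show ?thesis .
qed

text \<open>As a triangle has three vertices, the sizes 1 and 2 of \<open>T \<inter> S\<close> are
  exactly those that are neither empty nor full. The numerator of the triangle expansion thus counts
  the triangles cut by \<open>S\<close>.\<close>

lemma triangles_meeting_1_2:
  assumes "finite V"
  shows "triangles_meeting V E 2 S + triangles_meeting V E 1 S
    = card {T \<in> triangles V E. T \<inter> S \<noteq> {} \<and> \<not> T \<subseteq> S}"
proof -
  have "{T \<in> triangles V E. T \<inter> S \<noteq> {} \<and> \<not> T \<subseteq> S}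
     = {T \<in> triangles V E. card (T \<inter> S) = 2} \<union> {T \<in> triangles V E. card (T \<inter> S) = 1}"
  proof -
    have "T \<inter> S \<noteq> {} \<and> \<not> T \<subseteq> S \<longleftrightarrow> card (T \<inter> S) = 2 \<or> card (T \<inter> S) = 1"
      if "T \<in> triangles V E" for T
    proof -
      have T: "finite T" "card T = 3" using that by (auto simp: triangles_def nsets_def)
      have "card (T \<inter> S) = 0 \<longleftrightarrow> T \<inter> S = {}" using T by simp
      moreover have "card (T \<inter> S) \<le> 3" using card_mono[of T "T \<inter> S"] T by simp
      moreover have "card (T \<inter> S) = 3 \<longleftrightarrow> T \<subseteq> S"
        using card_subset_eq[of T "T \<inter> S"] T by (auto simp: Int_absorb2)
      ultimately show ?thesis by auto
    qed
    then show ?thesis by blast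
  qed
  moreover have "{T \<in> triangles V E. card (T \<inter> S) = 2} \<inter> {T \<in> triangles V E. card (T \<inter> S) = 1} = {}"
    by auto
  ultimately show ?thesis
    using finite_triangles[OF assms, of E]
    by (simp add: triangles_meeting_def card_Un_disjoint)
qed


section \<open>Stars\<close>

definition star_edges :: "nat \<Rightarrow> nat set set" where
  "star_edges n = (\<lambda>j. {0, j}) ` {1..<n}"

lemma star_edges_iff:
  "{u, v} \<in> star_edges n \<longleftrightarrow> u < n \<and> v < n \<and> (u = 0 \<and> v \<noteq> 0 \<or> u \<noteq> 0 \<and> v = 0)"
  by (auto simp: star_edges_def image_iff doubleton_eq_iff Bex_def)

lemma simple_graph_star: "simple_graph {..<n} (star_edges n)"
  by (auto simp: simple_graph_def star_edges_def nsets_def)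

text \<open>The centre 0 lies on only one side, so the other side is independent; an edge from the
  centre to that side makes the cut positive.\<close>

lemma edge_expansion_star:
  assumes "S \<subseteq> {..<n}" "S \<noteq> {}" "S \<noteq> {..<n}"
  shows "edge_expansion {..<n} (star_edges n) unit_weight S = 1"
proof -
  obtain u v where uv: "u \<in> S" "v \<in> {..<n} - S"
    using assms by blast
  have "0 < n" using uv by auto
  have "cut_weight {..<n} (star_edges n) unit_weight S > 0"
  proof (cases "0 \<in> S")
    case True
    with uv show ?thesis
      by (intro cut_weight_pos[of _ _ 0 v]) (use assms in \<open>auto simp: star_edges_iff intro: gr0I\<close>)
  next
    case False
    with uv \<open>0 < n\<close> show ?thesis
      by (intro cut_weight_pos[of _ _ u 0]) (use assms in \<open>auto simp: star_edges_iff intro: gr0I\<close>)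
  qed
  moreover have "(\<forall>u\<in>S. u \<noteq> 0) \<or> (\<forall>u\<in>{..<n} - S. u \<noteq> 0)"
    by (metis DiffD2)
  then have "(\<forall>u\<in>S. \<forall>v\<in>S. {u, v} \<notin> star_edges n)
      \<or> (\<forall>u\<in>{..<n} - S. \<forall>v\<in>{..<n} - S. {u, v} \<notin> star_edges n)"
    unfolding star_edges_iff by blast
  ultimately show ?thesis
    using assms(1) by (intro edge_expansion_independent) auto
qed

text \<open>In a triangle with vertices \<open>x < y < z\<close>, neither \<open>y\<close> nor
  \<open>z\<close> could be the centre 0, yet every edge contains it.\<close>

lemma triangles_star: "triangles V (star_edges n) = {}"
proof -
  have False if "T \<in> triangles V (star_edges n)" for T
    using that by (rule triangle_vertices) (simp add: star_edges_iff)
  then show ?thesis by blast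
qed


section \<open>Linked books\<close>

text \<open>Vertices below 4 are the hubs; a leaf \<open>v \<ge> 4\<close> belongs to the book on the hubs \<open>v mod 4\<close>
  and \<open>(v + 1) mod 4\<close>. The relation is not symmetric, only the edge set is.\<close>

definition linked_adj :: "nat \<Rightarrow> nat \<Rightarrow> bool" where
  "linked_adj u v \<longleftrightarrow> u \<noteq> v \<and>
     (if u < 4 then u = v mod 4 \<or> u = (v + 1) mod 4
      else 4 \<le> v \<and> u mod 4 = (v + 2) mod 4)"

definition linked_books :: "nat \<Rightarrow> nat set set" where
  "linked_books n = {{u, v} | u v. u < n \<and> v < n \<and> linked_adj u v}"

definition book_page :: "nat \<Rightarrow> nat set" where
  "book_page v = {v, v mod 4, (v + 1) mod 4}"

lemma linked_books_iff:
  "{u, v} \<in> linked_books n \<longleftrightarrow> u < n \<and> v < n \<and> (linked_adj u v \<or> linked_adj v u)"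
  by (auto simp: linked_books_def doubleton_eq_iff)

lemma simple_graph_linked_books: "simple_graph {..<n} (linked_books n)"
  by (auto simp: simple_graph_def linked_books_def linked_adj_def nsets_def)

section \<open>Residues modulo 4 and pages of books\<close>

lemma mod_4_shift:
  fixes a j :: nat
  shows "(4 * j + 4 + a) mod 4 = a mod 4"
proof -
  have "4 * j + 4 + a = a + 4 * (j + 1)" by simp
  then show ?thesis by (simp only: mod_mult_self2)
qed

lemma mod_4_neq:
  fixes v :: nat
  shows "v mod 4 \<noteq> (v + 1) mod 4" "v mod 4 \<noteq> (v + 2) mod 4"
  by (simp_all add: mod_Suc)

lemma mod_4_opposite:
  fixes u v :: nat
  shows "v mod 4 = (u + 2) mod 4 \<Longrightarrow> u mod 4 = (v + 2) mod 4"
  using mod_add_cong[of v 4 "u + 2" 2 2] by simp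

lemma card_book_page:
  assumes "4 \<le> v"
  shows "card (book_page v) = 3"
proof -
  have "v mod 4 < 4" "(v + 1) mod 4 < 4" by auto
  then have "v \<noteq> v mod 4" "v \<noteq> (v + 1) mod 4" using assms by linarith+
  then show ?thesis using mod_4_neq(1)[of v] by (simp add: book_page_def)
qed

text \<open>The leaf is the only element of its page that is at least 4, so the page determines
  it.\<close>

lemma inj_on_book_page: "inj_on book_page {4..}"
proof
  fix u v :: nat
  assume uv: "u \<in> {4..}" "v \<in> {4..}" "book_page u = book_page v"
  have "u \<in> book_page v" using uv(3) by (auto simp: book_page_def)
  moreover have "v mod 4 < 4" "(v + 1) mod 4 < 4" by auto
  ultimately show "u = v" using uv(1) by (auto simp: book_page_def)
qed

text \<open>Symmetrized adjacency for an ordered pair, split by the number of hubs. Between hubs,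
  \<open>u \<noteq> v\<close> rules out \<open>u = v mod 4\<close>, so
  \<open>u = (v + 1) mod 4\<close> is left and gives the 4-cycle; between leaves, being opposite is
  already symmetric because 2 + 2 = 4.\<close>

lemma linked_adj_less:
  assumes "u < v"
  shows "linked_adj u v \<or> linked_adj v u \<longleftrightarrow>
    (if v < 4 then v = u + 1 \<or> u = 0 \<and> v = 3
     else if u < 4 then u = v mod 4 \<or> u = (v + 1) mod 4
     else u mod 4 = (v + 2) mod 4)"
proof -
  have neq: "u \<noteq> v" "v \<noteq> u" using assms by auto
  consider "v < 4" | "u < 4" "4 \<le> v" | "4 \<le> u" by linarith
  then show ?thesis
  proof cases
    case 1
    then have "v = 0 \<or> v = 1 \<or> v = 2 \<or> v = 3" "u = 0 \<or> u = 1 \<or> u = 2 \<or> u = 3"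
      using assms by linarith+
    then show ?thesis using assms by (elim disjE) (simp_all add: linked_adj_def)
  next
    case 2
    then have "\<not> v < 4" "\<not> 4 \<le> u" by auto
    with 2 neq show ?thesis by (simp only: linked_adj_def if_True if_False simp_thms)
  next
    case 3
    then have "\<not> u < 4" "\<not> v < 4" "4 \<le> v" using assms by auto
    then have "linked_adj u v \<or> linked_adj v u \<longleftrightarrow>
        u mod 4 = (v + 2) mod 4 \<or> v mod 4 = (u + 2) mod 4"
      using 3 neq by (simp only: linked_adj_def if_False simp_thms)
    moreover have "v mod 4 = (u + 2) mod 4 \<longleftrightarrow> u mod 4 = (v + 2) mod 4"
      using mod_4_opposite by blast
    ultimately show ?thesis
      using \<open>\<not> u < 4\<close> \<open>\<not> v < 4\<close> by (simp only: if_False simp_thms)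
  qed
qed

text \<open>The cases are three, two, one or no hubs among the vertices. The 4-cycle of hubs has no
  triangle, and two hubs with a leaf form the page of that leaf. The other two cases are impossible,
  by residues modulo 4.\<close>

lemma linked_triangle:
  assumes "x < y" "y < z"
    and "linked_adj x y \<or> linked_adj y x" "linked_adj y z \<or> linked_adj z y"
    and "linked_adj x z \<or> linked_adj z x"
  shows "4 \<le> z \<and> {x, y, z} = book_page z"
proof -
  note adj = assms(3)[unfolded linked_adj_less[OF assms(1)]]
    assms(4)[unfolded linked_adj_less[OF assms(2)]]
    assms(5)[unfolded linked_adj_less[OF less_trans[OF assms(1,2)]]]
  consider "z < 4" | "4 \<le> z" "y < 4" | "x < 4" "4 \<le> y" | "4 \<le> x" by linarith
  then show ?thesis
  proof cases
    case 1
    then have "y < 4" using assms(2) by simp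
    with 1 adj have "y = x + 1 \<or> x = 0 \<and> y = 3" "z = y + 1 \<or> y = 0 \<and> z = 3"
      "z = x + 1 \<or> x = 0 \<and> z = 3"
      by (simp_all only: if_True)
    then have False using assms(1,2) by arith
    then show ?thesis ..
  next
    case 2
    then have "\<not> z < 4" "x < 4" using assms(1) by auto
    with 2 adj have "y = z mod 4 \<or> y = (z + 1) mod 4" "x = z mod 4 \<or> x = (z + 1) mod 4"
      by (simp_all only: if_True if_False)
    with assms(1) have "{x, y} = {z mod 4, (z + 1) mod 4}"
      by (metis insert_commute less_irrefl)
    moreover have "{x, y, z} = insert z {x, y}" by blast
    ultimately show ?thesis using 2(1) by (simp only: book_page_def simp_thms)
  next
    case 3
    then have "\<not> y < 4" "\<not> z < 4" using assms(2) by auto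
    with 3 adj have yz: "y mod 4 = (z + 2) mod 4"
      and "x = y mod 4 \<or> x = (y + 1) mod 4" "x = z mod 4 \<or> x = (z + 1) mod 4"
      by (simp_all only: if_True if_False)
    \<comment> \<open>The hubs of the leaf \<open>y\<close> are the residues of \<open>z + 2\<close>
      and \<open>z + 3\<close>, those of \<open>z\<close> are the residues of \<open>z\<close> and
      \<open>z + 1\<close>. No hub \<open>x\<close> is joined to both.\<close>
    moreover have "(y + 1) mod 4 = (z + 3) mod 4"
      using yz mod_add_cong[of y 4 "z + 2" 1 1] by (simp add: add.commute)
    moreover have "z mod 4 \<noteq> (z + 2) mod 4" "z mod 4 \<noteq> (z + 3) mod 4"
      "(z + 1) mod 4 \<noteq> (z + 2) mod 4" "(z + 1) mod 4 \<noteq> (z + 3) mod 4"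
      by (simp_all add: mod_Suc numeral_3_eq_3)
    ultimately have False by metis
    then show ?thesis ..
  next
    case 4
    then have "\<not> x < 4" "\<not> y < 4" "\<not> z < 4" using assms(1,2) by auto
    with adj have "y mod 4 = (z + 2) mod 4" "x mod 4 = (y + 2) mod 4" "x mod 4 = (z + 2) mod 4"
      by (simp_all only: if_False)
    \<comment> \<open>The opposite of the opposite book is the book itself: \<open>x\<close> would
      be in the same book as \<open>z\<close> and also in the one opposite to it.\<close>
    then have False
      using mod_4_opposite[of y z] mod_4_neq(2)[of z] by metis
    then show ?thesis ..
  qed
qed

lemma triangles_linked_books: "triangles {..<n} (linked_books n) = book_page ` {4..<n}"
proof (intro equalityI subsetI)
  fix T assume T: "T \<in> triangles {..<n} (linked_books n)"
  then obtain x y z where xyz: "T = {x, y, z}" "x < y" "y < z"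
    and E: "{x, y} \<in> linked_books n" "{y, z} \<in> linked_books n" "{x, z} \<in> linked_books n"
    by (rule triangle_vertices)
  have "4 \<le> z \<and> {x, y, z} = book_page z"
    using E unfolding linked_books_iff by (intro linked_triangle xyz(2,3)) blast+
  moreover have "z < n" using E(2) unfolding linked_books_iff by blast
  ultimately show "T \<in> book_page ` {4..<n}" unfolding xyz(1) by simp
next
  fix T assume "T \<in> book_page ` {4..<n}"
  then obtain v where v: "T = book_page v" "4 \<le> v" "v < n" by auto
  have m: "v mod 4 < 4" "(v + 1) mod 4 < 4" by auto
  then have m': "v mod 4 < n" "(v + 1) mod 4 < n" using v by linarith+
  have neq: "v \<noteq> v mod 4" "v \<noteq> (v + 1) mod 4" using v(2) m by linarith+
  have "(v + 1) mod 4 = (v mod 4 + 1) mod 4" by (simp add: mod_simps)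
  then have "linked_adj ((v + 1) mod 4) (v mod 4)"
    unfolding linked_adj_def using m mod_4_neq(1)[of v] by metis
  then have "{v mod 4, (v + 1) mod 4} \<in> linked_books n"
    unfolding linked_books_iff using m' by blast
  moreover have "linked_adj (v mod 4) v" "linked_adj ((v + 1) mod 4) v"
    unfolding linked_adj_def using m neq by metis+
  then have "{v, v mod 4} \<in> linked_books n" "{v, (v + 1) mod 4} \<in> linked_books n"
    unfolding linked_books_iff using v m' by blast+
  ultimately have "nsets T 2 \<subseteq> linked_books n"
    unfolding v(1) book_page_def by (intro nsets_2_triple)
  moreover have "T \<subseteq> {..<n}" unfolding v(1) book_page_def using v(3) m' by blast
  moreover have "finite T" by (simp add: v(1) book_page_def)
  ultimately show "T \<in> triangles {..<n} (linked_books n)"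
    using card_book_page[OF v(2)] by (simp add: triangles_def nsets_def v(1))
qed

text \<open>Each of the \<open>4 * m\<close> triangles adds at most 3 to the volume, which is
  therefore at most \<open>12 * m\<close>. Hence \<open>m\<close> cut triangles suffice for the
  constant 1/12; only a set without hubs needs a direct comparison.\<close>

lemma triangle_expansion_linked_books:
  assumes m: "0 < m" and S: "S \<subseteq> {..<4 * m + 4}" "S \<noteq> {}" "2 * card S \<le> 4 * m + 4"
  shows "1 / 12 \<le> triangle_expansion {..<4 * m + 4} (linked_books (4 * m + 4)) S"
proof -
  let ?V = "{..<4 * m + 4}" and ?L = "{4..<4 * m + 4}"
  let ?E = "linked_books (4 * m + 4)"
  define C where "C = {v \<in> ?L. book_page v \<inter> S \<noteq> {} \<and> \<not> book_page v \<subseteq> S}"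
  have finS: "finite S" using S finite_subset by blast
  have inj: "inj_on book_page ?L" by (rule inj_on_subset[OF inj_on_book_page]) auto
  have tri: "triangles ?V ?E = book_page ` ?L" by (simp add: triangles_linked_books)
  have "{T \<in> triangles ?V ?E. T \<inter> S \<noteq> {} \<and> \<not> T \<subseteq> S} = book_page ` C"
    by (auto simp: tri C_def)
  moreover have "inj_on book_page C" by (rule inj_on_subset[OF inj]) (auto simp: C_def)
  ultimately have crossing: "triangles_meeting ?V ?E 2 S + triangles_meeting ?V ?E 1 S = card C"
    using triangles_meeting_1_2[of ?V ?E S] by (simp add: card_image)
  have vol: "vol3 ?V ?E S = (\<Sum>v\<in>?L. card (book_page v \<inter> S))"
    using S by (simp add: vol3_eq_sum_card tri sum.reindex[OF inj])
  have vol_le: "vol3 ?V ?E S \<le> 12 * m"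
  proof -
    have "card (book_page v \<inter> S) \<le> 3" if "v \<in> ?L" for v
      using card_mono[of "book_page v" "book_page v \<inter> S"] card_book_page[of v] that
      by (auto simp: book_page_def)
    then have "vol3 ?V ?E S \<le> (\<Sum>v\<in>?L. 3)" unfolding vol by (intro sum_mono) auto
    then show ?thesis by simp
  qed
  \<comment> \<open>A zero volume would make the expansion 0 by default. A hub \<open>x\<close> lies
    on the page of the leaf \<open>x + 4\<close>, which exists because \<open>m\<close> is
    positive.\<close>
  have vol_pos: "0 < vol3 ?V ?E S"
  proof -
    obtain x where x: "x \<in> S" using S by blast
    define v where "v = (if x < 4 then x + 4 else x)"
    have "x < 4 * m + 4" using x S(1) by auto
    then have v: "v \<in> ?L" "x \<in> book_page v"
      using m by (cases "x < 4"; simp add: v_def book_page_def)+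
    then have "0 < card (book_page v \<inter> S)" using x finS by (auto simp: card_gt_0_iff)
    with v(1) show ?thesis unfolding vol by (intro sum_pos2[of _ v]) auto
  qed
  have finC: "finite C" by (simp add: C_def)
  have "vol3 ?V ?E S \<le> 12 * card C"
  proof -
    \<comment> \<open>If no two consecutive hubs are separated, going around the cycle puts all four
      on the same side.\<close>
    consider (none) "S \<inter> {..<4} = {}" | (all) "{..<4} \<subseteq> S"
      | (some) i where "i < 4" "(i \<in> S) \<noteq> ((i + 1) mod 4 \<in> S)"
    proof -
      have "S \<inter> {..<4} = {} \<or> {..<4} \<subseteq> S"
        if h: "\<forall>i<4. (i \<in> S) = ((i + 1) mod 4 \<in> S)"
      proof -
        have "i \<in> S \<longleftrightarrow> j \<in> S" if "i < 4" "(i + 1) mod 4 = j" for i j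
          using h that by blast
        from this[of 0 1] this[of 1 2] this[of 2 3]
        have "0 \<in> S \<longleftrightarrow> 1 \<in> S" "1 \<in> S \<longleftrightarrow> 2 \<in> S" "2 \<in> S \<longleftrightarrow> 3 \<in> S"
          by simp_all
        moreover have "{..<4::nat} = {0, 1, 2, 3}" by auto
        ultimately show ?thesis by simp
      qed
      then show ?thesis using none all some by blast
    qed
    then show ?thesis
    proof cases
      case none
      \<comment> \<open>A triangle can meet \<open>S\<close> only in its leaf. It then adds 1 to the
        volume and is itself cut, so volume and number of cut triangles agree.\<close>
      have page: "book_page v \<inter> S = {v} \<inter> S" for v
      proof -
        have "v mod 4 < 4" "(v + 1) mod 4 < 4" by auto
        then have "v mod 4 \<notin> S" "(v + 1) mod 4 \<notin> S" using none by blast+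
        then show ?thesis unfolding book_page_def by blast
      qed
      have "v mod 4 \<notin> S" for v
      proof -
        have "v mod 4 < 4" by auto
        then show ?thesis using none by blast
      qed
      then have "C = ?L \<inter> S" unfolding C_def page unfolding book_page_def by blast
      moreover have "vol3 ?V ?E S = card (?L \<inter> S)"
      proof -
        have "card ({v} \<inter> S) = of_bool (v \<in> S)" for v by auto
        then show ?thesis unfolding vol page by (simp add: Int_def)
      qed
      ultimately show ?thesis by simp
    next
      case all
      have "v mod 4 \<in> S" for v
      proof -
        have "v mod 4 < 4" by auto
        then show ?thesis using all by blast
      qed
      \<comment> \<open>The hubs of such a page are in \<open>S\<close> while its leaf is not. The
        complement of \<open>S\<close> consists of leaves only and has at least
        \<open>2 * m + 2\<close> elements.\<close>
      then have "?L - S \<subseteq> C" unfolding C_def book_page_def by blast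
      then have "card (?L - S) \<le> card C" using finC by (rule card_mono[rotated])
      moreover have "card (?V - S) = 4 * m + 4 - card S"
        using S finS by (simp add: card_Diff_subset)
      moreover have "?V = {..<4} \<union> ?L" by auto
      then have "?V - S = ?L - S" using all by blast
      ultimately have "m \<le> card C" using S(3) by simp
      then show ?thesis using vol_le by linarith
    next
      case some
      \<comment> \<open>These are the \<open>m\<close> leaves of the book on the separated hubs
        \<open>i\<close> and \<open>(i + 1) mod 4\<close>; each of their pages contains both
        hubs.\<close>
      have "4 * j + 4 + i \<in> C" if "j < m" for j
      proof -
        have "(4 * j + 4 + i) mod 4 = i" "(4 * j + 4 + i + 1) mod 4 = (i + 1) mod 4"
          using mod_4_shift[of j i] mod_4_shift[of j "i + 1"] some(1)
          by (simp_all only: add.assoc mod_less)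
        then have "i \<in> book_page (4 * j + 4 + i)" "(i + 1) mod 4 \<in> book_page (4 * j + 4 + i)"
          by (simp_all only: book_page_def insert_iff simp_thms)
        moreover have "4 * j + 4 + i \<in> ?L" using some(1) that by simp
        ultimately show ?thesis using some(2) unfolding C_def by blast
      qed
      then have "(\<lambda>j. 4 * j + 4 + i) ` {..<m} \<subseteq> C" by blast
      then have "card ((\<lambda>j. 4 * j + 4 + i) ` {..<m}) \<le> card C"
        using finC by (rule card_mono[rotated])
      then have "m \<le> card C" by (simp add: card_image inj_on_def)
      then show ?thesis using vol_le by linarith
    qed
  qed
  then have "real (vol3 ?V ?E S) \<le> 12 * real (card C)" by linarith
  then show ?thesis
    using vol_pos unfolding triangle_expansion_def crossing by (simp add: field_simps)
qed

section \<open>Small edge expansion of the linked books\<close>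

lemma wdegree_linked_leaf_ge:
  assumes "4 \<le> v" "v < 4 * m + 4"
  shows "real m \<le> wdegree {..<4 * m + 4} (linked_books (4 * m + 4)) unit_weight v"
proof -
  let ?V = "{..<4 * m + 4}" and ?E = "linked_books (4 * m + 4)"
  define r where "r = (v + 2) mod 4"
  \<comment> \<open>Enumerates the \<open>m\<close> leaves of the book opposite to that of
    \<open>v\<close>, all of them neighbours of \<open>v\<close>.\<close>
  let ?f = "\<lambda>j. 4 * j + 4 + r"
  have "?f j < 4 * m + 4 \<and> {v, ?f j} \<in> ?E" if "j < m" for j
  proof -
    have "?f j mod 4 = (v + 2) mod 4"
      by (simp only: mod_4_shift r_def mod_mod_trivial)
    then have "v \<noteq> ?f j" "v mod 4 = (?f j + 2) mod 4"
      using mod_4_neq(2)[of v] mod_4_opposite by metis+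
    moreover have "\<not> v < 4" "4 \<le> ?f j" using assms(1) by simp_all
    ultimately have "linked_adj v (?f j)" unfolding linked_adj_def by metis
    moreover have "r < 4" by (simp add: r_def)
    then have "?f j < 4 * m + 4" using that by linarith
    ultimately show ?thesis unfolding linked_books_iff using assms(2) by blast
  qed
  then have "?f ` {..<m} \<subseteq> {u \<in> ?V. {v, u} \<in> ?E}" by blast
  then have "card (?f ` {..<m}) \<le> card {u \<in> ?V. {v, u} \<in> ?E}"
    by (intro card_mono) auto
  moreover have "card (?f ` {..<m}) = m" by (simp add: card_image inj_on_def)
  ultimately show ?thesis
    by (simp add: wdegree_def edge_weight_unit Int_def)
qed

lemma edge_expansion_linked_books:
  assumes m: "0 < m"
  shows "\<exists>S \<subseteq> {..<4 * m + 4}. S \<noteq> {} \<and> 2 * card S \<le> 4 * m + 4 \<and>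
    edge_expansion {..<4 * m + 4} (linked_books (4 * m + 4)) unit_weight S \<le> 4 / real m"
proof -
  let ?V = "{..<4 * m + 4}" and ?E = "linked_books (4 * m + 4)"
  \<comment> \<open>The even leaves form the opposite books 0 and 2. The odd leaves
    \<open>S'\<close> form the books 1 and 3; they serve to bound the volume of the complement from
    below, as the denominator is a minimum.\<close>
  define S where "S = (\<lambda>j. 2 * j + 4) ` {..<2 * m}"
  define S' where "S' = (\<lambda>j. 2 * j + 5) ` {..<2 * m}"
  have card: "card S = 2 * m" "card S' = 2 * m"
    by (simp_all add: S_def S'_def card_image inj_on_def)
  have sub: "S \<subseteq> ?V" "S' \<subseteq> ?V - S"
    unfolding S_def S'_def by auto presburger+
  have leaf: "4 \<le> v \<and> v < 4 * m + 4" if "v \<in> S \<union> S'" for v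
    using that unfolding S_def S'_def by auto
  have vol_ge: "2 * real m * real m \<le> vol ?V ?E unit_weight A"
    if "B \<subseteq> A" "A \<subseteq> ?V" "card B = 2 * m" "B \<subseteq> S \<union> S'" for A B
  proof -
    have fin: "finite A" using that finite_subset by blast
    have "(\<Sum>v\<in>B. real m) \<le> (\<Sum>v\<in>B. wdegree ?V ?E unit_weight v)"
      using that leaf by (intro sum_mono wdegree_linked_leaf_ge) blast+
    also have "\<dots> \<le> (\<Sum>v\<in>A. wdegree ?V ?E unit_weight v)"
      using that fin by (intro sum_mono2) (auto simp: wdegree_def edge_weight_unit intro!: sum_nonneg)
    finally show ?thesis using that by (simp add: vol_def)
  qed
  have vols: "2 * real m * real m \<le> min (vol ?V ?E unit_weight S) (vol ?V ?E unit_weight (?V - S))"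
    using vol_ge[of S S] vol_ge[of S' "?V - S"] card sub by auto
  \<comment> \<open>Adjacent leaves differ by 2 modulo 4 and so have equal parity. All neighbours of
    an even leaf outside \<open>S\<close> are therefore hubs, of which there are four.\<close>
  have "(\<Sum>j\<in>?V - S. edge_weight ?E unit_weight i j) \<le> 4" if "i \<in> S" for i
  proof -
    have i: "4 \<le> i" "even i" using that by (auto simp: S_def)
    have "j < 4" if j: "j \<in> ?V - S" "{i, j} \<in> ?E" for j
    proof (rule ccontr)
      assume "\<not> j < 4"
      with i j(2) have "i mod 4 = (j + 2) mod 4 \<or> j mod 4 = (i + 2) mod 4"
        unfolding linked_books_iff linked_adj_def by (metis not_less)
      moreover have "even (a mod 4) \<longleftrightarrow> even a" for a :: nat
        by (intro dvd_mod_iff) simp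
      ultimately have "even j" using i(2) by (metis even_add even_two_times_div_two dvd_refl)
      then obtain l where l: "j = 2 * l" by (elim evenE)
      then have "j = 2 * (l - 2) + 4" "l - 2 < 2 * m" using \<open>\<not> j < 4\<close> j(1) by auto
      then have "j \<in> S" unfolding S_def by blast
      with j(1) show False by simp
    qed
    then have "{j \<in> ?V - S. {i, j} \<in> ?E} \<subseteq> {..<4}" by auto
    then have "card {j \<in> ?V - S. {i, j} \<in> ?E} \<le> card {..<4::nat}" by (intro card_mono) auto
    then show ?thesis by (simp add: edge_weight_unit Int_def)
  qed
  then have "cut_weight ?V ?E unit_weight S \<le> (\<Sum>i\<in>S. 4)"
    unfolding cut_weight_def by (rule sum_mono)
  then have cut: "cut_weight ?V ?E unit_weight S \<le> 8 * real m" by (simp add: card)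
  have "edge_expansion ?V ?E unit_weight S \<le> 8 * real m / (2 * real m * real m)"
    unfolding edge_expansion_def
    using cut vols m by (intro frac_le) auto
  also have "\<dots> = 4 / real m" using m by simp
  finally have "edge_expansion ?V ?E unit_weight S \<le> 4 / real m" .
  moreover have "S \<noteq> {}" using card m by auto
  ultimately show ?thesis using card sub by (intro exI[of _ S]) auto
qed


section \<open>The two families of graphs\<close>

lemma filterlim_card_lessThan:
  assumes "\<And>k. k \<le> f k"
  shows "filterlim (\<lambda>k. card {..<f k}) at_top sequentially"
  using filterlim_at_top_mono[OF filterlim_ident, of "\<lambda>k. card {..<f k}"] assms
  by simp

theorem theorem5:
  "(\<exists>(V :: nat \<Rightarrow> nat set) E. graph_family V E
      \<and> edge_expander V E (\<lambda>_. unit_weight) \<and> \<not> triangle_expander V E)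
   \<and> (gnp_triangle_expander_whp (\<lambda>n. ln (real n) / real n powr (2 / 3)) \<longrightarrow>
      (\<exists>(V :: nat \<Rightarrow> nat set) E. graph_family V E
         \<and> triangle_expander V E \<and> \<not> edge_expander V E (\<lambda>_. unit_weight)))"
proof (intro conjI impI)
  \<comment> \<open>With at least two vertices, the singleton \<open>{0}\<close> has at most half of
    them and can witness the failure of triangle expansion.\<close>
  let ?V = "\<lambda>k::nat. {..<k + 2}" and ?E = "\<lambda>k. star_edges (k + 2)"
  have "graph_family ?V ?E"
    unfolding graph_family_def using filterlim_card_lessThan[of "\<lambda>k. k + 2"]
    by (auto simp: simple_graph_star simp del: card_lessThan)
  moreover have "edge_expansion_ge 1 (?V k) (?E k) unit_weight" for k
    unfolding edge_expansion_ge_def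
  proof (intro allI impI)
    fix S assume S: "S \<subseteq> ?V k" "S \<noteq> {} \<and> 2 * card S \<le> card (?V k)"
    then have "S \<noteq> ?V k" by auto
    then show "1 \<le> edge_expansion (?V k) (?E k) unit_weight S"
      using S edge_expansion_star[of S "k + 2"] by simp
  qed
  then have "edge_expander ?V ?E (\<lambda>_. unit_weight)"
    unfolding edge_expander_def by (intro exI[of _ 1]) auto
  moreover have "\<not> triangle_expansion_ge c (?V k) (?E k)" if "c > 0" for c k
  proof -
    have "triangle_expansion (?V k) (?E k) {0} = 0"
      by (simp add: triangle_expansion_def triangles_meeting_def triangles_star)
    then show ?thesis
      using that unfolding triangle_expansion_ge_def by (auto intro!: exI[of _ "{0}"])
  qed
  then have "\<not> triangle_expander ?V ?E"
    unfolding triangle_expander_def by auto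
  ultimately show "\<exists>(V :: nat \<Rightarrow> nat set) E. graph_family V E
      \<and> edge_expander V E (\<lambda>_. unit_weight) \<and> \<not> triangle_expander V E"
    by blast
next
  let ?V = "\<lambda>k::nat. {..<4 * k + 4}" and ?E = "\<lambda>k. linked_books (4 * k + 4)"
  have "graph_family ?V ?E"
    unfolding graph_family_def using filterlim_card_lessThan[of "\<lambda>k. 4 * k + 4"]
    by (auto simp: simple_graph_linked_books simp del: card_lessThan)
  moreover have "triangle_expander ?V ?E"
  proof -
    \<comment> \<open>For \<open>k = 0\<close> there are no leaves, hence no triangles, and every
      expansion is 0.\<close>
    have "triangle_expansion_ge (1 / 12) (?V k) (?E k)" if "0 < k" for k
      unfolding triangle_expansion_ge_def
      by (intro allI impI triangle_expansion_linked_books that) auto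
    then have "\<forall>\<^sub>F k in sequentially. triangle_expansion_ge (1 / 12) (?V k) (?E k)"
      by (rule eventually_mono[OF eventually_gt_at_top])
    then show ?thesis unfolding triangle_expander_def by (intro exI[of _ "1 / 12"]) auto
  qed
  moreover have "\<not> edge_expander ?V ?E (\<lambda>_. unit_weight)"
  proof
    assume "edge_expander ?V ?E (\<lambda>_. unit_weight)"
    then obtain c where c: "c > 0"
      and ev: "\<forall>\<^sub>F k in sequentially. edge_expansion_ge c (?V k) (?E k) unit_weight"
      unfolding edge_expander_def by blast
    \<comment> \<open>From here on the upper bound \<open>4 / real k\<close> on the expansion of the
      even leaves is below \<open>c\<close>.\<close>
    have "\<forall>\<^sub>F k in sequentially. 4 / c < real k"
      using filterlim_real_sequentially by (simp add: filterlim_at_top_dense)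
    with ev eventually_gt_at_top[of 0] have "\<forall>\<^sub>F k::nat in sequentially. False"
    proof eventually_elim
      case (elim k)
      obtain S where S: "S \<subseteq> ?V k" "S \<noteq> {}" "2 * card S \<le> 4 * k + 4"
        and "edge_expansion (?V k) (?E k) unit_weight S \<le> 4 / real k"
        using edge_expansion_linked_books[OF elim(2)] by blast
      moreover have "c \<le> edge_expansion (?V k) (?E k) unit_weight S"
        using elim(1) S unfolding edge_expansion_ge_def by simp
      moreover have "4 / real k < c" using elim c by (simp add: field_simps)
      ultimately show False by linarith
    qed
    then show False by simp
  qed
  ultimately show "\<exists>(V :: nat \<Rightarrow> nat set) E. graph_family V E
         \<and> triangle_expander V E \<and> \<not> edge_expander V E (\<lambda>_. unit_weight)"
    by blast
qed

end
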